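(* For every positive integer $n$, the number $\lambda(n)$ of isomorphism classes of linear $L$-algebras with exactly $n$ elements equals the Bell number $B(n-1)$, i.e. the number of partitions of a set with $n-1$ elements into non-empty subsets (with $B(0)=1$).
   Context: An $L$-algebra is a set $X$ together with a binary operation $(x,y)\mapsto x\cdot y$ such that: (i) there exists $e\in X$ with $e\cdot x=x$ and $x\cdot e=x\cdot x=e$ for all $x\in X$; (ii) $(x\cdot y)\cdot(x\cdot z)=(y\cdot x)\cdot(y\cdot z)$ for all $x,y,z\in X$; (iii) if $x\cdot y=y\cdot x=e$, then $x=y$. The natural order is the partial order $x\le y\iff x\cdot y=e$. An $L$-algebra is linear if for all $x,y\in X$, $x\le y$ or $y\le x$. An isomorphism of $L$-algebras is a bijection $f$ with $f(x\cdot y)=f(x)\cdot f(y)$ for all $x,y$. *)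

theory Defs
  imports Main "HOL-Library.Disjoint_Sets"
begin

definition logical_unit :: "'a set \<Rightarrow> ('a \<Rightarrow> 'a \<Rightarrow> 'a) \<Rightarrow> 'a \<Rightarrow> bool" where
  "logical_unit X f e \<longleftrightarrow>
     e \<in> X \<and> (\<forall>x\<in>X. f e x = x \<and> f x e = e \<and> f x x = e)"

definition L_algebra :: "'a set \<Rightarrow> ('a \<Rightarrow> 'a \<Rightarrow> 'a) \<Rightarrow> bool" where
  "L_algebra X f \<longleftrightarrow>
     (\<forall>x\<in>X. \<forall>y\<in>X. f x y \<in> X) \<and>
     (\<forall>x\<in>X. \<forall>y\<in>X. \<forall>z\<in>X. f (f x y) (f x z) = f (f y x) (f y z)) \<and>
     (\<exists>e. logical_unit X f e \<and> (\<forall>x\<in>X. \<forall>y\<in>X. f x y = e \<and> f y x = e \<longrightarrow> x = y))"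

definition L_unit :: "'a set \<Rightarrow> ('a \<Rightarrow> 'a \<Rightarrow> 'a) \<Rightarrow> 'a" where
  "L_unit X f = (THE e. logical_unit X f e)"

definition L_le :: "'a set \<Rightarrow> ('a \<Rightarrow> 'a \<Rightarrow> 'a) \<Rightarrow> 'a \<Rightarrow> 'a \<Rightarrow> bool" where
  "L_le X f x y \<longleftrightarrow> f x y = L_unit X f"

definition linear_L_algebra :: "'a set \<Rightarrow> ('a \<Rightarrow> 'a \<Rightarrow> 'a) \<Rightarrow> bool" where
  "linear_L_algebra X f \<longleftrightarrow>
     L_algebra X f \<and> (\<forall>x\<in>X. \<forall>y\<in>X. L_le X f x y \<or> L_le X f y x)"

definition L_isomorphic ::
    "'a set \<times> ('a \<Rightarrow> 'a \<Rightarrow> 'a) \<Rightarrow> 'b set \<times> ('b \<Rightarrow> 'b \<Rightarrow> 'b) \<Rightarrow> bool" where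
  "L_isomorphic = (\<lambda>(X, f) (Y, g).
     \<exists>h. bij_betw h X Y \<and> (\<forall>x\<in>X. \<forall>y\<in>X. h (f x y) = g (h x) (h y)))"

text \<open>
  The carriers range over all \<open>n\<close>-element sets of natural numbers. This loses nothing: by
  \<open>linear_L_algebra_nat_copy\<close> below, every finite linear \<open>L\<close>-algebra, over any type, is isomorphic
  to one of these. The values of an operation outside its carrier are irrelevant, since operations
  that agree on the carrier give isomorphic structures and hence the same class.
\<close>

definition linear_L_algebras :: "nat \<Rightarrow> (nat set \<times> (nat \<Rightarrow> nat \<Rightarrow> nat)) set" where
  "linear_L_algebras n = {(X, f). finite X \<and> card X = n \<and> linear_L_algebra X f}"

definition L_iso_rel ::
    "nat \<Rightarrow> ((nat set \<times> (nat \<Rightarrow> nat \<Rightarrow> nat)) \<times> (nat set \<times> (nat \<Rightarrow> nat \<Rightarrow> nat))) set" where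
  "L_iso_rel n =
     {(A, B). A \<in> linear_L_algebras n \<and> B \<in> linear_L_algebras n \<and> L_isomorphic A B}"

definition num_linear_L_algebras :: "nat \<Rightarrow> nat" where
  "num_linear_L_algebras n = card (linear_L_algebras n // L_iso_rel n)"

definition Bell :: "nat \<Rightarrow> nat" where
  "Bell n = card {P. partition_on {..<n} P}"

lemma Bell_0: "Bell 0 = 1"
proof -
  have "{P :: nat set set. partition_on {..<0} P} = {{}}"
    by (auto simp: partition_on_def)
  then show ?thesis by (simp add: Bell_def)
qed

lemma logical_unit_unique:
  assumes "logical_unit X f e" "logical_unit X f e'"
  shows "e = e'"
  using assms unfolding logical_unit_def by metis

lemma L_unit_eq:
  assumes "logical_unit X f e"
  shows "L_unit X f = e"
  unfolding L_unit_def using assms logical_unit_unique by (metis the_equality)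

lemma L_isomorphic_refl: "L_isomorphic A A"
  unfolding L_isomorphic_def by (auto intro!: exI[of _ id] split: prod.split)

lemma L_isomorphic_trans:
  assumes "L_isomorphic A B" "L_isomorphic B C"
  shows "L_isomorphic A C"
proof -
  obtain X f Y g Z k where eq: "A = (X, f)" "B = (Y, g)" "C = (Z, k)"
    by (metis surj_pair)
  obtain h1 h2 where
    h1: "bij_betw h1 X Y" "\<forall>x\<in>X. \<forall>y\<in>X. h1 (f x y) = g (h1 x) (h1 y)" and
    h2: "bij_betw h2 Y Z" "\<forall>x\<in>Y. \<forall>y\<in>Y. h2 (g x y) = k (h2 x) (h2 y)"
    using assms unfolding eq L_isomorphic_def by auto
  have "bij_betw (h2 \<circ> h1) X Z" using h1(1) h2(1) by (rule bij_betw_trans)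
  moreover have "\<forall>x\<in>X. \<forall>y\<in>X. (h2 \<circ> h1) (f x y) = k ((h2 \<circ> h1) x) ((h2 \<circ> h1) y)"
    using h1 h2(2) by (auto simp: bij_betw_def)
  ultimately show ?thesis unfolding eq L_isomorphic_def by blast
qed

lemma L_isomorphic_sym:
  assumes "L_isomorphic (X, f) (Y, g)" and closed: "\<forall>x\<in>X. \<forall>y\<in>X. f x y \<in> X"
  shows "L_isomorphic (Y, g) (X, f)"
proof -
  obtain h where h: "bij_betw h X Y" "\<forall>x\<in>X. \<forall>y\<in>X. h (f x y) = g (h x) (h y)"
    using assms unfolding L_isomorphic_def by auto
  define i where "i = inv_into X h"
  have i: "bij_betw i Y X" unfolding i_def using h(1) by (rule bij_betw_inv_into)
  have "i (g x y) = f (i x) (i y)" if "x \<in> Y" "y \<in> Y" for x y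
  proof -
    have m: "i x \<in> X" "i y \<in> X" using i that by (auto simp: bij_betw_def)
    have "h (i x) = x" "h (i y) = y"
      using that h(1) unfolding i_def by (auto simp: bij_betw_inv_into_right)
    then have "g x y = h (f (i x) (i y))" using h(2) m by simp
    then show ?thesis
      using closed m h(1) unfolding i_def by (simp add: bij_betw_inv_into_left)
  qed
  with i show ?thesis unfolding L_isomorphic_def by auto
qed

lemma equiv_L_iso_rel: "equiv (linear_L_algebras n) (L_iso_rel n)"
proof (rule equivI)
  show "L_iso_rel n \<subseteq> linear_L_algebras n \<times> linear_L_algebras n"
    by (auto simp: L_iso_rel_def)
  show "refl_on (linear_L_algebras n) (L_iso_rel n)"
    by (auto simp: refl_on_def L_iso_rel_def L_isomorphic_refl)
  show "sym (L_iso_rel n)"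
    by (auto simp: sym_def L_iso_rel_def linear_L_algebras_def linear_L_algebra_def L_algebra_def
        intro!: L_isomorphic_sym)
  show "trans (L_iso_rel n)"
    by (auto simp: trans_def L_iso_rel_def intro: L_isomorphic_trans)
qed

lemma linear_L_algebra_nat_copy:
  fixes X :: "'a set"
  assumes lin: "linear_L_algebra X f" and fin: "finite X"
  shows "\<exists>A \<in> linear_L_algebras (card X). L_isomorphic (X, f) A"
proof -
  define Y where "Y = {0..<card X}"
  obtain h :: "'a \<Rightarrow> nat" where h: "bij_betw h X Y"
    using ex_bij_betw_finite_nat[OF fin] Y_def by blast
  define i where "i = inv_into X h"
  define g where "g u v = h (f (i u) (i v))" for u v
  have hX: "h ` X = Y" using h by (auto simp: bij_betw_def)
  have ih: "\<And>x. x \<in> X \<Longrightarrow> i (h x) = x"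
    unfolding i_def using h by (simp add: bij_betw_inv_into_left)
  have inj: "\<And>x y. x \<in> X \<Longrightarrow> y \<in> X \<Longrightarrow> h x = h y \<longleftrightarrow> x = y"
    using h by (auto simp: bij_betw_def inj_on_def)
  have gh: "\<And>x y. x \<in> X \<Longrightarrow> y \<in> X \<Longrightarrow> g (h x) (h y) = h (f x y)"
    by (simp add: g_def ih)
  have closed: "\<And>x y. x \<in> X \<Longrightarrow> y \<in> X \<Longrightarrow> f x y \<in> X"
    and cycloid: "\<And>x y z. x \<in> X \<Longrightarrow> y \<in> X \<Longrightarrow> z \<in> X \<Longrightarrow> f (f x y) (f x z) = f (f y x) (f y z)"
    using lin by (auto simp: linear_L_algebra_def L_algebra_def)
  obtain e where e: "logical_unit X f e"
    and anti: "\<And>x y. x \<in> X \<Longrightarrow> y \<in> X \<Longrightarrow> f x y = e \<Longrightarrow> f y x = e \<Longrightarrow> x = y"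
    using lin unfolding linear_L_algebra_def L_algebra_def by blast
  have eX: "e \<in> X" using e by (simp add: logical_unit_def)
  have tot: "\<And>x y. x \<in> X \<Longrightarrow> y \<in> X \<Longrightarrow> f x y = e \<or> f y x = e"
    using lin L_unit_eq[OF e] by (auto simp: linear_L_algebra_def L_le_def)
  have u: "logical_unit Y g (h e)"
    using e eX unfolding logical_unit_def hX[symmetric] by (simp add: gh)
  have "L_algebra Y g"
    unfolding L_algebra_def
  proof (intro conjI exI[of _ "h e"])
    show "\<forall>x\<in>Y. \<forall>y\<in>Y. g x y \<in> Y"
      unfolding hX[symmetric] by (auto simp: gh closed)
    show "\<forall>x\<in>Y. \<forall>y\<in>Y. \<forall>z\<in>Y. g (g x y) (g x z) = g (g y x) (g y z)"
      unfolding hX[symmetric] by (simp add: gh closed cycloid)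
    show "\<forall>x\<in>Y. \<forall>y\<in>Y. g x y = h e \<and> g y x = h e \<longrightarrow> x = y"
      unfolding hX[symmetric] by (auto simp: gh closed inj eX anti)
  qed (rule u)
  moreover have "\<forall>x\<in>Y. \<forall>y\<in>Y. L_le Y g x y \<or> L_le Y g y x"
    unfolding L_le_def L_unit_eq[OF u] unfolding hX[symmetric] using tot by (auto simp: gh closed inj eX)
  ultimately have "(Y, g) \<in> linear_L_algebras (card X)"
    by (simp add: linear_L_algebras_def linear_L_algebra_def Y_def)
  moreover have "L_isomorphic (X, f) (Y, g)"
    using h gh unfolding L_isomorphic_def by auto
  ultimately show ?thesis by blast
qed

end

theory Submission
  imports Defs "HOL.Binomial"
begin

text \<open>
  Number the elements of a linear \<open>L\<close>-algebra \<open>0, \<dots>, n - 1\<close> from the top. The rows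
  \<open>k \<mapsto> f i k\<close> are strictly increasing on \<open>{i..<n}\<close> with \<open>f i i = 0\<close>, and the defining equation
  becomes \<open>f (f i j) (f i k) = f j k\<close> for \<open>i \<le> j \<le> k\<close>. Finite chains are rigid, so isomorphism
  classes correspond to such operations. Let \<open>g\<close> be the first row that moves the bottom element
  \<open>n - 1\<close>. Applying the equation to a row \<open>i < g\<close> and the bottom element shows that \<open>f i\<close> fixes \<open>g\<close>,
  hence everything from \<open>g\<close> on. The later rows are determined by row \<open>g\<close>, because
  \<open>f j k = f (f g j) (f g k)\<close> with \<open>f g j < j\<close>. Conversely, any operation on \<open>{..<g}\<close> and any
  strictly increasing row \<open>{g<..<n} \<rightarrow> {1..n - 2}\<close> can be combined in this way. Therefore
  \<open>\<lambda>(n) = (\<Sum>g=1..n - 1. (n - 2 choose g - 1) * \<lambda>(g))\<close>, which is the recurrence of the Bell numbers.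
\<close>

section \<open>Equivalence classes and linear orders\<close>

lemma card_quotient_eq_card_representatives:
  assumes equiv: "equiv A r" and "R \<subseteq> A"
    and represented: "\<And>x. x \<in> A \<Longrightarrow> \<exists>y\<in>R. (y, x) \<in> r"
    and distinct: "\<And>x y. x \<in> R \<Longrightarrow> y \<in> R \<Longrightarrow> (x, y) \<in> r \<Longrightarrow> x = y"
  shows "card (A // r) = card R"
proof -
  have "bij_betw (\<lambda>x. r `` {x}) R (A // r)"
  proof (rule bij_betw_imageI)
    show "inj_on (\<lambda>x. r `` {x}) R"
      using eq_equiv_class[OF _ equiv] \<open>R \<subseteq> A\<close> distinct by (intro inj_onI) blast
    show "(\<lambda>x. r `` {x}) ` R = A // r"
    proof
      show "(\<lambda>x. r `` {x}) ` R \<subseteq> A // r"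
        using \<open>R \<subseteq> A\<close> by (auto intro: quotientI)
      show "A // r \<subseteq> (\<lambda>x. r `` {x}) ` R"
      proof
        fix C assume "C \<in> A // r"
        then obtain x where x: "x \<in> A" "C = r `` {x}" by (auto elim: quotientE)
        then obtain y where "y \<in> R" "(y, x) \<in> r" using represented by blast
        then show "C \<in> (\<lambda>x. r `` {x}) ` R"
          using x equiv_class_eq[OF equiv] by blast
      qed
    qed
  qed
  then show ?thesis by (simp add: bij_betw_same_card)
qed

lemma linear_order_iff_card_underS_le:
  assumes "finite A" and r: "linear_order_on A r" and xy: "x \<in> A" "y \<in> A"
  shows "(x, y) \<in> r \<longleftrightarrow> card (underS r x) \<le> card (underS r y)"
proof -
  have order: "refl_on A r" "trans r" "antisym r" "r \<subseteq> A \<times> A" "total_on A r"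
    using r partial_order_onD[of A r] by (simp_all add: linear_order_on_def)
  have card_less: "card (underS r u) < card (underS r v)" if "(u, v) \<in> r" "u \<noteq> v" for u v
  proof (rule psubset_card_mono)
    show "finite (underS r v)"
      using \<open>finite A\<close> order(4) by (auto simp: underS_def intro: finite_subset)
    have "underS r u \<subseteq> underS r v"
      using that order(2,3) unfolding underS_def by (auto dest: transD antisymD)
    moreover have "u \<in> underS r v" "u \<notin> underS r u"
      using that by (simp_all add: underS_def)
    ultimately show "underS r u \<subset> underS r v" by blast
  qed
  consider "x = y" | "x \<noteq> y" "(x, y) \<in> r" | "x \<noteq> y" "(y, x) \<in> r"
    using xy order(5) unfolding total_on_def by blast
  then show ?thesis
    using xy card_less[of x y] card_less[of y x] order(1) by cases (auto simp: refl_on_def)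
qed

lemma bij_betw_card_underS:
  assumes "finite A" and r: "linear_order_on A r"
  shows "bij_betw (\<lambda>x. card (underS r x)) A {..<card A}"
proof (rule bij_betw_imageI)
  have order: "antisym r" "r \<subseteq> A \<times> A"
    using r partial_order_onD[of A r] by (simp_all add: linear_order_on_def)
  show inj: "inj_on (\<lambda>x. card (underS r x)) A"
    by (rule inj_onI)
      (metis antisymD[OF order(1)] linear_order_iff_card_underS_le[OF assms] order_refl)
  have "underS r x \<subset> A" if "x \<in> A" for x
    using that order(2) by (auto simp: underS_def)
  then have "(\<lambda>x. card (underS r x)) ` A \<subseteq> {..<card A}"
    using psubset_card_mono[OF \<open>finite A\<close>] by auto
  then show "(\<lambda>x. card (underS r x)) ` A = {..<card A}"
    by (intro card_subset_eq) (simp_all add: card_image inj)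
qed

lemma finite_linear_order_enumeration:
  assumes "finite A" "linear_order_on A r"
  obtains s where "bij_betw s {..<card A} A"
    and "\<And>i j. i < card A \<Longrightarrow> j < card A \<Longrightarrow> (s i, s j) \<in> r \<longleftrightarrow> i \<le> j"
proof
  let ?s = "inv_into A (\<lambda>x. card (underS r x))"
  show s: "bij_betw ?s {..<card A} A"
    using bij_betw_card_underS[OF assms] by (rule bij_betw_inv_into)
  show "(?s i, ?s j) \<in> r \<longleftrightarrow> i \<le> j" if "i < card A" "j < card A" for i j
    using that linear_order_iff_card_underS_le[OF assms] bij_betwE[OF s]
      bij_betw_inv_into_right[OF bij_betw_card_underS[OF assms]] by simp
qed

section \<open>Strictly increasing maps\<close>

lemma strict_mono_on_eqI:
  fixes \<phi> \<psi> :: "'a::linorder \<Rightarrow> 'b::linorder"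
  assumes "finite I" "strict_mono_on I \<phi>" "strict_mono_on I \<psi>" "\<phi> ` I = \<psi> ` I" "x \<in> I"
  shows "\<phi> x = \<psi> x"
proof -
  let ?xs = "sorted_list_of_set I"
  have "sorted_wrt (<) (map \<chi> ?xs)" if "strict_mono_on I \<chi>" for \<chi> :: "'a \<Rightarrow> 'b"
    unfolding sorted_wrt_map
    by (rule sorted_wrt_mono_rel[of ?xs "(<)"])
      (use \<open>finite I\<close> that in \<open>auto dest: strict_mono_onD\<close>)
  then have "map \<phi> ?xs = map \<psi> ?xs"
    using assms by (intro strict_sorted_equal) auto
  then show ?thesis using \<open>finite I\<close> \<open>x \<in> I\<close> by auto
qed

lemma strict_mono_on_onto_exists:
  fixes I :: "'a::linorder set" and A :: "'b::linorder set"
  assumes "finite I" "finite A" "card A = card I"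
  obtains \<psi> where "strict_mono_on I \<psi>" "\<psi> ` I = A"
proof
  let ?\<psi> = "\<lambda>x. sorted_list_of_set A ! card {y \<in> I. y < x}"
  have rank: "card {y \<in> I. y < x} < card I" if "x \<in> I" for x
    using that \<open>finite I\<close> by (intro psubset_card_mono) auto
  have rank_mono: "card {y \<in> I. y < x} < card {y \<in> I. y < x'}" if "x \<in> I" "x < x'" for x x'
    using that \<open>finite I\<close> by (intro psubset_card_mono) auto
  show mono: "strict_mono_on I ?\<psi>"
  proof (rule strict_mono_onI)
    fix x x' assume "x \<in> I" "x' \<in> I" "x < x'"
    then show "?\<psi> x < ?\<psi> x'"
      using rank[of x'] rank_mono[of x x'] \<open>card A = card I\<close>
      by (intro sorted_wrt_nth_less[of "(<)"]) simp_all
  qed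
  have "?\<psi> ` I \<subseteq> A"
  proof (rule image_subsetI)
    fix x assume "x \<in> I"
    then show "?\<psi> x \<in> A"
      using rank[of x] assms(2,3) nth_mem[of _ "sorted_list_of_set A"] by simp
  qed
  then show "?\<psi> ` I = A"
    using assms(2,3) strict_mono_on_imp_inj_on[OF mono]
    by (intro card_subset_eq) (simp_all add: card_image)
qed

definition strict_mono_maps :: "'a::linorder set \<Rightarrow> 'b::linorder set \<Rightarrow> 'b \<Rightarrow> ('a \<Rightarrow> 'b) set" where
  "strict_mono_maps I B d = {\<psi>. strict_mono_on I \<psi> \<and> \<psi> ` I \<subseteq> B \<and> (\<forall>x. x \<notin> I \<longrightarrow> \<psi> x = d)}"

lemma bij_betw_strict_mono_maps_image:
  assumes "finite I" "finite B"
  shows "bij_betw (\<lambda>\<psi>. \<psi> ` I) (strict_mono_maps I B d) {A. A \<subseteq> B \<and> card A = card I}"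
proof (rule bij_betw_imageI)
  show "inj_on (\<lambda>\<psi>. \<psi> ` I) (strict_mono_maps I B d)"
  proof (intro inj_onI ext)
    fix \<phi> \<psi> x assume "\<phi> \<in> strict_mono_maps I B d" "\<psi> \<in> strict_mono_maps I B d" "\<phi> ` I = \<psi> ` I"
    then show "\<phi> x = \<psi> x"
      using strict_mono_on_eqI[OF \<open>finite I\<close>, of \<phi> \<psi> x]
      by (cases "x \<in> I") (simp_all add: strict_mono_maps_def)
  qed
  show "(\<lambda>\<psi>. \<psi> ` I) ` strict_mono_maps I B d = {A. A \<subseteq> B \<and> card A = card I}"
  proof (intro equalityI subsetI)
    fix A assume "A \<in> (\<lambda>\<psi>. \<psi> ` I) ` strict_mono_maps I B d"
    then show "A \<in> {A. A \<subseteq> B \<and> card A = card I}"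
      by (auto simp: strict_mono_maps_def card_image strict_mono_on_imp_inj_on)
  next
    fix A assume A: "A \<in> {A. A \<subseteq> B \<and> card A = card I}"
    then have "finite A" "card A = card I" using \<open>finite B\<close> finite_subset by auto
    with \<open>finite I\<close> obtain \<psi> where \<psi>: "strict_mono_on I \<psi>" "\<psi> ` I = A"
      by (rule strict_mono_on_onto_exists)
    define \<psi>' where "\<psi>' x = (if x \<in> I then \<psi> x else d)" for x
    have "\<psi>' \<in> strict_mono_maps I B d" "\<psi>' ` I = A"
      using \<psi> A by (auto simp: strict_mono_maps_def \<psi>'_def strict_mono_on_def)
    then show "A \<in> (\<lambda>\<psi>. \<psi> ` I) ` strict_mono_maps I B d" by blast
  qed
qed

lemma
  assumes "finite I" "finite B"
  shows finite_strict_mono_maps: "finite (strict_mono_maps I B d)"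
    and card_strict_mono_maps: "card (strict_mono_maps I B d) = card B choose card I"
  using bij_betw_finite[OF bij_betw_strict_mono_maps_image[OF assms]]
    bij_betw_same_card[OF bij_betw_strict_mono_maps_image[OF assms]]
    n_subsets[OF \<open>finite B\<close>] \<open>finite B\<close>
  by simp_all

lemma strict_mono_on_nat_add_diff_le:
  fixes \<psi> :: "nat \<Rightarrow> nat"
  assumes "strict_mono_on {k..l} \<psi>" "k \<le> l"
  shows "\<psi> k + (l - k) \<le> \<psi> l"
  using assms(2,1)
proof (induction l rule: dec_induct)
  case (step l)
  have "\<psi> k + (l - k) \<le> \<psi> l"
    using step.prems by (intro step.IH) (auto intro: monotone_on_subset)
  also have "\<psi> l < \<psi> (Suc l)"
    using step by (auto intro: strict_mono_onD)
  finally show ?case using step.hyps by simp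
qed simp

section \<open>Bell numbers\<close>

lemma partition_on_bij_image:
  assumes "partition_on A P" "bij_betw h A B"
  shows "partition_on B ((`) h ` P)"
  using partition_on_inj_image[of A P h] partition_onD3[OF assms(1)] assms
  by (simp add: bij_betw_def image_iff)

lemma bij_betw_partitions:
  assumes h: "bij_betw h A B"
  shows "bij_betw ((`) ((`) h)) {P. partition_on A P} {Q. partition_on B Q}"
proof (rule bij_betw_subset[OF bij_betw_Pow[OF bij_betw_Pow[OF h]]])
  show "{P. partition_on A P} \<subseteq> Pow (Pow A)"
    by (auto dest: partition_onD1)
  show "(`) ((`) h) ` {P. partition_on A P} = {Q. partition_on B Q}"
  proof (intro equalityI subsetI)
    fix Q assume "Q \<in> (`) ((`) h) ` {P. partition_on A P}"
    then show "Q \<in> {Q. partition_on B Q}" using partition_on_bij_image[OF _ h] by auto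
  next
    fix Q assume "Q \<in> {Q. partition_on B Q}"
    then have Q: "partition_on B Q" by simp
    let ?P = "(`) (inv_into A h) ` Q"
    have "(`) h ` ?P = (\<lambda>q. q) ` Q"
      unfolding image_image[of "(`) h"]
      using image_inv_into_cancel[OF bij_betw_imp_surj_on[OF h]] partition_onD1[OF Q]
      by (intro image_cong) auto
    moreover have "partition_on A ?P"
      using Q bij_betw_inv_into[OF h] by (rule partition_on_bij_image)
    ultimately show "Q \<in> (`) ((`) h) ` {P. partition_on A P}" by auto
  qed
qed

lemma card_partitions_eq_Bell:
  assumes "finite A"
  shows "card {P. partition_on A P} = Bell (card A)"
proof -
  obtain h where "bij_betw h A {..<card A}"
    using ex_bij_betw_finite_nat[OF assms] by (auto simp: atLeast0LessThan)
  then show ?thesis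
    unfolding Bell_def by (rule bij_betw_same_card[OF bij_betw_partitions])
qed

lemma sum_Pow_card:
  fixes F :: "nat \<Rightarrow> 'a::semiring_1"
  assumes "finite S"
  shows "(\<Sum>A\<in>Pow S. F (card A)) = (\<Sum>k\<le>card S. of_nat (card S choose k) * F k)"
proof -
  have "(\<Sum>A\<in>Pow S. F (card A)) = (\<Sum>k\<le>card S. \<Sum>A\<in>{A \<in> Pow S. card A = k}. F (card A))"
    by (rule sum.group[symmetric]) (use assms in \<open>auto intro: card_mono\<close>)
  also have "\<dots> = (\<Sum>k\<le>card S. of_nat (card {A. A \<subseteq> S \<and> card A = k}) * F k)"
    by (rule sum.cong) auto
  finally show ?thesis using assms by (simp add: n_subsets)
qed

lemma partition_on_insert_block:
  assumes "a \<notin> A" "R \<subseteq> A" "partition_on R Q"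
  shows "partition_on (insert a A) (insert (insert a (A - R)) Q)"
proof -
  have "disjnt (insert a (A - R)) (\<Union>Q)" "insert a A - insert a (A - R) = R"
    using assms partition_onD1[OF assms(3)] by (auto simp: disjnt_def)
  then show ?thesis
    using assms(3) by (auto simp: partition_on_insert)
qed

lemma partition_on_insert_blockE:
  assumes "a \<notin> A" "partition_on (insert a A) P"
  obtains R Q where "R \<subseteq> A" "partition_on R Q" "P = insert (insert a (A - R)) Q"
proof -
  obtain p where p: "p \<in> P" "a \<in> p"
    using assms(2) by (auto simp: partition_on_def)
  have "disjnt p (\<Union>(P - {p}))"
    using assms(2) p(1) by (auto simp: partition_on_def disjnt_def pairwise_def)
  then have P: "partition_on (insert a A - p) (P - {p})" "p \<subseteq> insert a A"
    using assms(2) p(1) partition_on_insert[of p "P - {p}"] by (auto simp: insert_absorb)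
  moreover have "insert a (A - (insert a A - p)) = p" using p(2) P(2) by auto
  ultimately show thesis
    using p by (intro that[of "insert a A - p" "P - {p}"]) (auto simp: insert_absorb)
qed

text \<open>The block of \<open>a\<close> is the complement of \<open>R\<close>.\<close>

lemma bij_betw_partitions_insert:
  assumes "a \<notin> A"
  shows "bij_betw (\<lambda>(R, Q). insert (insert a (A - R)) Q)
           (SIGMA R:Pow A. {Q. partition_on R Q}) {P. partition_on (insert a A) P}"
    (is "bij_betw ?F ?D _")
proof (rule bij_betw_imageI)
  show "inj_on ?F ?D"
  proof (rule inj_on_inverseI)
    fix x assume "x \<in> ?D"
    then obtain R Q where x: "x = (R, Q)" "R \<subseteq> A" "partition_on R Q" by auto
    then have "a \<notin> \<Union>Q" using assms partition_onD1[of R Q] by blast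
    then have "{p \<in> ?F x. a \<notin> p} = Q" using x(1) by auto
    then show "(\<lambda>P. (\<Union>{p \<in> P. a \<notin> p}, {p \<in> P. a \<notin> p})) (?F x) = x"
      using x partition_onD1[of R Q] by simp
  qed
  show "?F ` ?D = {P. partition_on (insert a A) P}"
  proof (intro equalityI subsetI)
    show "P \<in> {P. partition_on (insert a A) P}" if "P \<in> ?F ` ?D" for P
      using that partition_on_insert_block[OF assms] by auto
    fix P assume "P \<in> {P. partition_on (insert a A) P}"
    then obtain R Q where "R \<subseteq> A" "partition_on R Q" "P = insert (insert a (A - R)) Q"
      using partition_on_insert_blockE[OF assms] by blast
    then show "P \<in> ?F ` ?D" by (intro image_eqI[of _ _ "(R, Q)"]) auto
  qed
qed

lemma Bell_Suc: "Bell (Suc m) = (\<Sum>k\<le>m. (m choose k) * Bell k)"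
proof -
  have "Bell (Suc m) = card (SIGMA R:Pow {..<m}. {Q. partition_on R Q})"
    unfolding Bell_def lessThan_Suc
    by (rule bij_betw_same_card[OF bij_betw_partitions_insert, symmetric]) simp
  also have "\<dots> = (\<Sum>R\<in>Pow {..<m}. card {Q. partition_on R Q})"
    by (rule card_SigmaI) (auto intro: finitely_many_partition_on finite_subset)
  also have "\<dots> = (\<Sum>R\<in>Pow {..<m}. Bell (card R))"
    by (rule sum.cong) (auto intro: card_partitions_eq_Bell finite_subset)
  also have "\<dots> = (\<Sum>k\<le>m. (m choose k) * Bell k)"
    by (simp add: sum_Pow_card)
  finally show ?thesis .
qed

section \<open>Linear \<open>L\<close>-algebras on an initial segment of the natural numbers\<close>

text \<open>
  The natural order is the reverse of the order of the numbers. The value \<open>0\<close> outside the carrier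
  makes an operation determined by its restriction to the carrier.
\<close>

locale L_chain =
  fixes n :: nat and f :: "nat \<Rightarrow> nat \<Rightarrow> nat"
  assumes unit_left: "k < n \<Longrightarrow> f 0 k = k"
    and eq_0: "k \<le> i \<or> n \<le> k \<Longrightarrow> f i k = 0"
    and closed: "k < n \<Longrightarrow> f i k < n"
    and strict_mono_on_row: "strict_mono_on {i..<n} (f i)"
    and cycloid: "i \<le> j \<Longrightarrow> j \<le> k \<Longrightarrow> k < n \<Longrightarrow> f (f i j) (f i k) = f j k"
begin

lemma row_strict_mono: "i \<le> k \<Longrightarrow> k < l \<Longrightarrow> l < n \<Longrightarrow> f i k < f i l"
  using strict_mono_onD[OF strict_mono_on_row, of k i l] by simp

lemma row_mono:
  assumes "k \<le> l" "l < n"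
  shows "f i k \<le> f i l"
  using assms row_strict_mono[of i k l] eq_0[of k i] by (cases "k = l"; cases "k \<le> i") auto

lemma row_add_diff_le: "i \<le> k \<Longrightarrow> k \<le> l \<Longrightarrow> l < n \<Longrightarrow> f i k + (l - k) \<le> f i l"
  by (intro strict_mono_on_nat_add_diff_le monotone_on_subset[OF strict_mono_on_row[of i]]) auto

lemma row_le_self: "k < n \<Longrightarrow> f i k \<le> k"
  using row_add_diff_le[of i k "n - 1"] closed[of "n - 1" i] eq_0[of k i] by linarith

lemma eq_0_iff: "k < n \<Longrightarrow> f i k = 0 \<longleftrightarrow> k \<le> i"
  using row_strict_mono[of i i k] eq_0[of k i] by (cases "k \<le> i") auto

end

lemma L_chain_1_iff: "L_chain 1 f \<longleftrightarrow> f = (\<lambda>i k. 0)"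
proof
  assume "L_chain 1 f"
  then have "f i k = 0" for i k
    using L_chain.eq_0[of 1 f k i] by linarith
  then show "f = (\<lambda>i k. 0)" by blast
next
  assume "f = (\<lambda>i k. 0)"
  then show "L_chain 1 f" by unfold_locales (auto simp: strict_mono_on_def)
qed

lemma finite_L_chains: "finite {f. L_chain n f}"
proof -
  let ?rows = "{r. \<forall>k. (k \<in> {..<n} \<longrightarrow> r k \<in> {..<n}) \<and> (k \<notin> {..<n} \<longrightarrow> r k = 0)}"
  let ?ops = "{f. \<forall>i. (i \<in> {..<n} \<longrightarrow> f i \<in> ?rows) \<and> (i \<notin> {..<n} \<longrightarrow> f i = (\<lambda>k. 0))}"
  have "{f. L_chain n f} \<subseteq> ?ops"
  proof
    fix f assume "f \<in> {f. L_chain n f}"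
    then interpret L_chain n f by simp
    have "f i \<in> ?rows" for i by (simp add: closed eq_0)
    moreover have "f i = (\<lambda>k. 0)" if "\<not> i < n" for i
    proof
      show "f i k = 0" for k using that eq_0[of k i] by linarith
    qed
    ultimately show "f \<in> ?ops" by simp
  qed
  moreover have "finite ?ops"
    by (intro finite_set_of_finite_funs finite_lessThan)
  ultimately show ?thesis by (rule finite_subset)
qed

section \<open>Decomposition at the first row that moves the bottom element\<close>

definition restrict_below :: "nat \<Rightarrow> (nat \<Rightarrow> nat \<Rightarrow> nat) \<Rightarrow> nat \<Rightarrow> nat \<Rightarrow> nat" where
  "restrict_below g f j k = (if k < g then f j k else 0)"

definition first_moving_row :: "nat \<Rightarrow> (nat \<Rightarrow> nat \<Rightarrow> nat) \<Rightarrow> nat" where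
  "first_moving_row n f = (LEAST i. f i (n - 1) < n - 1)"

lemma first_moving_row_le: "f i (n - 1) < n - 1 \<Longrightarrow> first_moving_row n f \<le> i"
  unfolding first_moving_row_def by (rule Least_le)

lemma (in L_chain) L_chain_restrict_below:
  assumes "g \<le> n"
  shows "L_chain g (restrict_below g f)"
proof
  have row_less_g: "f i k < g" if "k < g" for i k
    using that assms row_le_self[of k i] by simp
  show "restrict_below g f 0 k = k" if "k < g" for k
    using that assms unit_left by (simp add: restrict_below_def)
  show "restrict_below g f i k = 0" if "k \<le> i \<or> g \<le> k" for i k
    using that eq_0 by (auto simp: restrict_below_def)
  show "restrict_below g f i k < g" if "k < g" for i k
    using that row_less_g by (simp add: restrict_below_def)
  show "strict_mono_on {i..<g} (restrict_below g f i)" for i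
    using assms row_strict_mono by (auto simp: restrict_below_def intro!: strict_mono_onI)
  show "restrict_below g f (restrict_below g f i j) (restrict_below g f i k) =
      restrict_below g f j k" if "i \<le> j" "j \<le> k" "k < g" for i j k
    using that assms row_less_g cycloid by (simp add: restrict_below_def)
qed

context L_chain
begin

context
  fixes g :: nat
  assumes two_le: "2 \<le> n" and g: "g = first_moving_row n f"
begin

lemma bottom_row_moves_bottom: "f (n - 1) (n - 1) < n - 1"
  using two_le by (simp add: eq_0)

lemma first_moving_row_moves: "f g (n - 1) < n - 1"
  unfolding g first_moving_row_def using bottom_row_moves_bottom by (rule LeastI)

lemma first_moving_row_bounds: "1 \<le> g" "g < n"
proof -
  show "1 \<le> g"
    using first_moving_row_moves unit_left[of "n - 1"] two_le by (cases "g = 0") auto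
  show "g < n"
    using first_moving_row_le[of f "n - 1" n] bottom_row_moves_bottom two_le g by simp
qed

lemma row_fixes_bottom: "j < g \<Longrightarrow> f j (n - 1) = n - 1"
  using first_moving_row_le[of f j n] row_le_self[of "n - 1" j] two_le g by linarith

lemma row_fixes_first_moving_row:
  assumes "j < g"
  shows "f j g = g"
proof (rule antisym)
  have "f (f j g) (n - 1) = f g (n - 1)"
    using cycloid[of j g "n - 1"] first_moving_row_bounds(2) row_fixes_bottom[OF assms] assms
    by simp
  then show "g \<le> f j g"
    using first_moving_row_moves first_moving_row_le[of f "f j g" n] g by simp
  show "f j g \<le> g"
    using first_moving_row_bounds(2) by (rule row_le_self)
qed

lemma row_fixes_from_first_moving_row: "j < g \<Longrightarrow> g \<le> k \<Longrightarrow> k < n \<Longrightarrow> f j k = k"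
  using row_fixes_first_moving_row[of j] row_add_diff_le[of j g k] row_le_self[of k j] by simp

lemma first_moving_row_in_strict_mono_maps: "f g \<in> strict_mono_maps {g<..<n} {1..<n - 1} 0"
proof -
  have "f g k \<in> {1..<n - 1}" if "k \<in> {g<..<n}" for k
  proof -
    have "f g g < f g k" using that by (intro row_strict_mono) auto
    moreover have "f g k \<le> f g (n - 1)" using that by (intro row_mono) auto
    ultimately show ?thesis using first_moving_row_moves by simp
  qed
  then show ?thesis
    using row_strict_mono[of g] eq_0[of _ g]
    by (auto simp: strict_mono_maps_def intro: strict_mono_onI)
qed

end

end

locale L_chain_extension = lower: L_chain g h for g :: nat and h :: "nat \<Rightarrow> nat \<Rightarrow> nat" +
  fixes n :: nat and \<psi> :: "nat \<Rightarrow> nat"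
  assumes g_pos: "1 \<le> g" and g_less: "g < n"
    and row: "\<psi> \<in> strict_mono_maps {g<..<n} {1..<n - 1} 0"
begin

lemma row_g: "\<psi> g = 0"
  using row by (simp add: strict_mono_maps_def)

lemma row_range: "k \<in> {g<..<n} \<Longrightarrow> \<psi> k \<in> {1..<n - 1}"
  using row unfolding strict_mono_maps_def by blast

lemma strict_mono_on_row: "strict_mono_on {g..<n} \<psi>"
proof (rule strict_mono_onI)
  fix k l assume "k \<in> {g..<n}" "l \<in> {g..<n}" "k < l"
  then show "\<psi> k < \<psi> l"
    using row row_g row_range[of l]
    by (cases "k = g") (auto simp: strict_mono_maps_def strict_mono_on_def)
qed

lemma row_mono: "g \<le> k \<Longrightarrow> k \<le> l \<Longrightarrow> l < n \<Longrightarrow> \<psi> k \<le> \<psi> l"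
  using strict_mono_on_leD[OF strict_mono_on_row, of k l] by simp

lemma row_less_self:
  assumes "g \<le> k" "k < n"
  shows "\<psi> k < k"
proof (cases "k = g")
  case False
  have "\<psi> k + (n - 1 - k) \<le> \<psi> (n - 1)"
    using assms
    by (intro strict_mono_on_nat_add_diff_le monotone_on_subset[OF strict_mono_on_row]) auto
  moreover have "\<psi> (n - 1) < n - 1"
    using row_range[of "n - 1"] False assms by simp
  ultimately show ?thesis using assms by linarith
qed (use row_g g_pos in simp)

function extend :: "nat \<Rightarrow> nat \<Rightarrow> nat" where
  "extend j k =
     (if k < g then h j k
      else if k \<le> j \<or> n \<le> k then 0
      else if j < g then k
      else extend (\<psi> j) (\<psi> k))"
  by auto
termination by (relation "measure fst") (auto intro: row_less_self)

declare extend.simps [simp del]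

lemma extend_below: "k < g \<Longrightarrow> extend j k = h j k"
  by (subst extend.simps) simp

lemma extend_fixes: "j < g \<Longrightarrow> g \<le> k \<Longrightarrow> k < n \<Longrightarrow> extend j k = k"
  by (subst extend.simps) simp

lemma extend_eq_0: "k \<le> j \<or> n \<le> k \<Longrightarrow> extend j k = 0"
  using g_less lower.eq_0[of k j] by (subst extend.simps) auto

lemma extend_unit_left: "k < n \<Longrightarrow> extend 0 k = k"
  using g_pos lower.unit_left[of k] extend_below[of k 0] extend_fixes[of 0 k]
  by (cases "k < g") auto

lemma extend_rec:
  assumes "g \<le> j" "j \<le> k" "k < n"
  shows "extend j k = extend (\<psi> j) (\<psi> k)"
  using assms by (cases "j = k") (simp_all add: extend_eq_0 extend.simps[of j k])

lemma extend_row: "extend g = \<psi>"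
proof
  fix k
  show "extend g k = \<psi> k"
  proof (cases "g \<le> k \<and> k < n")
    case True
    then show ?thesis
      using extend_rec[of g k] row_g row_less_self[of k] extend_unit_left[of "\<psi> k"] by simp
  next
    case False
    then show ?thesis
      using row extend_eq_0[of k g] by (auto simp: strict_mono_maps_def)
  qed
qed

lemma extend_less: "k < n \<Longrightarrow> extend j k < n"
proof (induction j arbitrary: k rule: less_induct)
  case (less j)
  consider "k < g" | "g \<le> k" "k \<le> j" | "g \<le> k" "j < g" | "g \<le> j" "j < k" by linarith
  then show ?case
  proof cases
    case 1
    then show ?thesis using lower.closed[of k j] g_less by (simp add: extend_below)
  next
    case 4
    then show ?thesis using less row_less_self[of j] row_less_self[of k] by (simp add: extend_rec)
  qed (use less.prems in \<open>simp_all add: extend_eq_0 extend_fixes\<close>)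
qed

lemma extend_strict_mono: "j \<le> k \<Longrightarrow> k < l \<Longrightarrow> l < n \<Longrightarrow> extend j k < extend j l"
proof (induction j arbitrary: k l rule: less_induct)
  case (less j)
  consider "l < g" | "k < g" "g \<le> l" | "g \<le> k" "j < g" | "g \<le> j" using less.prems by linarith
  then show ?case
  proof cases
    case 1
    then show ?thesis using lower.row_strict_mono[of j k l] less.prems by (simp add: extend_below)
  next
    case 2
    then show ?thesis using lower.closed[of k j] less.prems by (simp add: extend_below extend_fixes)
  next
    case 3
    then show ?thesis using less.prems by (simp add: extend_fixes)
  next
    case 4
    then have "\<psi> j < j" "\<psi> j \<le> \<psi> k" "\<psi> k < \<psi> l" "\<psi> l < n"
      using less.prems row_less_self[of j] row_less_self[of l] row_mono[of j k]
        strict_mono_onD[OF strict_mono_on_row, of k l] by auto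
    then show ?thesis using less.IH 4 less.prems by (simp add: extend_rec)
  qed
qed

lemma extend_cycloid:
  "i \<le> j \<Longrightarrow> j \<le> k \<Longrightarrow> k < n \<Longrightarrow> extend (extend i j) (extend i k) = extend j k"
proof (induction i arbitrary: j k rule: less_induct)
  case (less i)
  consider "k < g" | "j < g" "g \<le> k" | "g \<le> j" "i < g" | "g \<le> i" using less.prems by linarith
  then show ?case
  proof cases
    case 1
    then show ?thesis
      using less.prems lower.cycloid[of i j k] lower.closed[of k i] by (simp add: extend_below)
  next
    case 2
    then show ?thesis
      using less.prems lower.closed[of j i] by (simp add: extend_below extend_fixes)
  next
    case 3
    then show ?thesis using less.prems by (simp add: extend_fixes)
  next
    case 4
    then have "\<psi> i < i" "\<psi> i \<le> \<psi> j" "\<psi> j \<le> \<psi> k" "\<psi> k < n"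
      using less.prems row_less_self[of i] row_less_self[of k] row_mono by auto
    then show ?thesis using less.IH 4 less.prems by (simp add: extend_rec)
  qed
qed

lemma L_chain_extend: "L_chain n extend"
proof
  show "strict_mono_on {i..<n} (extend i)" for i
    by (auto intro!: strict_mono_onI extend_strict_mono)
qed (simp_all add: extend_unit_left extend_eq_0 extend_less extend_cycloid)

lemma first_moving_row_extend: "first_moving_row n extend = g"
  unfolding first_moving_row_def
proof (rule Least_equality)
  show "extend g (n - 1) < n - 1"
    using row_less_self[of "n - 1"] g_less by (simp add: extend_row)
  show "g \<le> i" if "extend i (n - 1) < n - 1" for i
    using extend_fixes[of i "n - 1"] g_less that by (cases "g \<le> i") auto
qed

lemma restrict_below_extend: "restrict_below g extend = h"
  using lower.eq_0 by (intro ext) (simp add: restrict_below_def extend_below)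

lemma extend_unique:
  assumes "L_chain n f" "restrict_below g f = h" "f g = \<psi>"
    and f_fixes: "\<And>j k. j < g \<Longrightarrow> g \<le> k \<Longrightarrow> k < n \<Longrightarrow> f j k = k"
  shows "extend = f"
proof -
  interpret f: L_chain n f by fact
  have "extend j k = f j k" for j k
  proof (induction j arbitrary: k rule: less_induct)
    case (less j)
    consider "k < g" | "k \<le> j \<or> n \<le> k" | "g \<le> k" "k < n" "j < g" | "g \<le> j" "j < k" "k < n"
      by linarith
    then show ?case
    proof cases
      case 1
      then show ?thesis
        using assms(2) by (auto simp: extend_below restrict_below_def)
    next
      case 4
      then have "extend j k = f (f g j) (f g k)"
        using less row_less_self[of j] assms(3) by (simp add: extend_rec)
      then show ?thesis using 4 f.cycloid by simp
    qed (simp_all add: extend_eq_0 f.eq_0 extend_fixes f_fixes)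
  qed
  then show ?thesis by blast
qed

end

lemma L_chain_extension_first_moving_row:
  assumes "L_chain n f" and g: "2 \<le> n" "g = first_moving_row n f"
  shows "L_chain_extension g (restrict_below g f) n (f g)"
    and "L_chain_extension.extend g (restrict_below g f) n (f g) = f"
proof -
  interpret L_chain n f by fact
  show extension: "L_chain_extension g (restrict_below g f) n (f g)"
    using first_moving_row_bounds[OF g] first_moving_row_in_strict_mono_maps[OF g]
    by (intro L_chain_extension.intro L_chain_extension_axioms.intro L_chain_restrict_below) auto
  show "L_chain_extension.extend g (restrict_below g f) n (f g) = f"
    by (rule L_chain_extension.extend_unique[OF extension])
      (use row_fixes_from_first_moving_row[OF g] in \<open>simp_all add: L_chain_axioms\<close>)
qed

lemma bij_betw_extend_L_chains:
  assumes "2 \<le> n"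
  shows "bij_betw (\<lambda>(g, h, \<psi>). L_chain_extension.extend g h n \<psi>)
           (SIGMA g:{1..<n}. {h. L_chain g h} \<times> strict_mono_maps {g<..<n} {1..<n - 1} 0)
           {f. L_chain n f}"
    (is "bij_betw ?extend ?D _")
proof (rule bij_betw_byWitness)
  let ?split = "\<lambda>f. let g = first_moving_row n f in (g, restrict_below g f, f g)"
  have extension: "L_chain_extension g h n \<psi>" if "(g, h, \<psi>) \<in> ?D" for g h \<psi>
    using that by (simp add: L_chain_extension_def L_chain_extension_axioms_def)
  show "\<forall>x\<in>?D. ?split (?extend x) = x"
    using extension by (auto simp: Let_def L_chain_extension.first_moving_row_extend
        L_chain_extension.restrict_below_extend L_chain_extension.extend_row)
  show "?extend ` ?D \<subseteq> {f. L_chain n f}"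
    using extension by (auto intro: L_chain_extension.L_chain_extend)
  show "\<forall>f\<in>{f. L_chain n f}. ?extend (?split f) = f"
    using L_chain_extension_first_moving_row(2)[OF _ assms refl] by (simp add: Let_def)
  show "?split ` {f. L_chain n f} \<subseteq> ?D"
    using L_chain_extension_first_moving_row(1)[OF _ assms refl]
    by (auto simp: Let_def L_chain_extension_def L_chain_extension_axioms_def)
qed

lemma card_L_chains_Suc_Suc:
  "card {f. L_chain (Suc (Suc m)) f} = (\<Sum>k\<le>m. (m choose k) * card {f. L_chain (Suc k) f})"
proof -
  let ?n = "Suc (Suc m)"
  let ?rows = "\<lambda>g. strict_mono_maps {g<..<?n} {1..<?n - 1} 0"
  have "card {f. L_chain ?n f} = card (SIGMA g:{1..<?n}. {h. L_chain g h} \<times> ?rows g)"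
    by (rule bij_betw_same_card[OF bij_betw_extend_L_chains, symmetric]) simp
  also have "\<dots> = (\<Sum>g\<in>{1..<?n}. card {h. L_chain g h} * card (?rows g))"
    by (subst card_SigmaI)
      (auto simp: finite_L_chains finite_strict_mono_maps card_cartesian_product)
  also have "\<dots> = (\<Sum>g\<in>{1..<?n}. (m choose (Suc m - g)) * card {h. L_chain g h})"
    by (simp add: card_strict_mono_maps mult.commute)
  also have "\<dots> = (\<Sum>k\<le>m. (m choose (m - k)) * card {h. L_chain (Suc k) h})"
    by (rule sum.reindex_bij_witness[of _ Suc "\<lambda>g. g - 1"]) auto
  also have "\<dots> = (\<Sum>k\<le>m. (m choose k) * card {f. L_chain (Suc k) f})"
    by (intro sum.cong) (simp_all flip: binomial_symmetric)
  finally show ?thesis .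
qed

lemma card_L_chains: "card {f. L_chain (Suc m) f} = Bell m"
proof (induction m rule: less_induct)
  case (less m)
  show ?case
  proof (cases m)
    case 0
    then show ?thesis using L_chain_1_iff by (simp add: Bell_0)
  next
    case (Suc p)
    then have "card {f. L_chain (Suc m) f} = (\<Sum>k\<le>p. (p choose k) * card {f. L_chain (Suc k) f})"
      using card_L_chains_Suc_Suc by simp
    also have "\<dots> = (\<Sum>k\<le>p. (p choose k) * Bell k)"
      using less.IH Suc by (intro sum.cong) simp_all
    finally show ?thesis by (simp add: Suc Bell_Suc)
  qed
qed

section \<open>The natural order\<close>

context
  fixes X :: "'a set" and f :: "'a \<Rightarrow> 'a \<Rightarrow> 'a"
  assumes L: "L_algebra X f"
begin

lemma L_algebra_closed: "x \<in> X \<Longrightarrow> y \<in> X \<Longrightarrow> f x y \<in> X"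
  using L by (simp add: L_algebra_def)

lemma L_algebra_cycloid:
  "x \<in> X \<Longrightarrow> y \<in> X \<Longrightarrow> z \<in> X \<Longrightarrow> f (f x y) (f x z) = f (f y x) (f y z)"
  using L unfolding L_algebra_def by blast

lemma logical_unit_L_unit: "logical_unit X f (L_unit X f)"
  using L L_unit_eq unfolding L_algebra_def by metis

lemma L_unit_mem: "L_unit X f \<in> X"
  using logical_unit_L_unit by (simp add: logical_unit_def)

lemma L_unit_left: "x \<in> X \<Longrightarrow> f (L_unit X f) x = x"
  and L_unit_right: "x \<in> X \<Longrightarrow> f x (L_unit X f) = L_unit X f"
  using logical_unit_L_unit by (simp_all add: logical_unit_def)

lemma L_le_antisym:
  assumes "x \<in> X" "y \<in> X" "L_le X f x y" "L_le X f y x"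
  shows "x = y"
  using L assms L_unit_eq unfolding L_algebra_def L_le_def by metis

lemma L_algebra_mult_below:
  assumes "x \<in> X" "y \<in> X" "z \<in> X" "L_le X f x y"
  shows "f (f y x) (f y z) = f x z"
  using assms L_algebra_cycloid[of x y z] L_unit_left L_algebra_closed by (simp add: L_le_def)

lemma L_le_trans:
  assumes "x \<in> X" "y \<in> X" "z \<in> X" "L_le X f x y" "L_le X f y z"
  shows "L_le X f x z"
  using assms L_algebra_mult_below[of x y z] L_unit_right L_algebra_closed by (simp add: L_le_def)

lemma partial_order_on_L_le: "partial_order_on X (relation_of (L_le X f) X)"
proof (rule partial_order_on_relation_ofI)
  show "L_le X f x x" if "x \<in> X" for x
    using that logical_unit_L_unit by (simp add: L_le_def logical_unit_def)
qed (blast intro: L_le_trans L_le_antisym)+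

end

lemma linear_order_on_L_le:
  assumes "linear_L_algebra X f"
  shows "linear_order_on X (relation_of (L_le X f) X)"
  using assms partial_order_on_L_le
  by (auto simp: linear_L_algebra_def linear_order_on_def total_on_def relation_of_def)

locale descending_enumeration =
  fixes X :: "'a set" and f :: "'a \<Rightarrow> 'a \<Rightarrow> 'a" and n :: nat and s :: "nat \<Rightarrow> 'a"
  assumes algebra: "L_algebra X f"
    and bij: "bij_betw s {..<n} X"
    and le_iff: "i < n \<Longrightarrow> k < n \<Longrightarrow> L_le X f (s i) (s k) \<longleftrightarrow> k \<le> i"

lemma linear_L_algebra_descending_enumeration:
  assumes "finite X" and linear: "linear_L_algebra X f"
  obtains s where "descending_enumeration X f (card X) s"
proof -
  have "linear_order_on X ((relation_of (L_le X f) X)\<inverse>)"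
    using linear_order_on_L_le[OF linear] by simp
  with \<open>finite X\<close> obtain s where s: "bij_betw s {..<card X} X"
    and order: "\<And>i k. i < card X \<Longrightarrow> k < card X \<Longrightarrow>
      (s i, s k) \<in> (relation_of (L_le X f) X)\<inverse> \<longleftrightarrow> i \<le> k"
    by (rule finite_linear_order_enumeration) blast
  have "L_le X f (s i) (s k) \<longleftrightarrow> k \<le> i" if "i < card X" "k < card X" for i k
    using that order[of k i] bij_betwE[OF s] by (simp add: relation_of_def)
  then have "descending_enumeration X f (card X) s"
    using linear s by (simp add: descending_enumeration_def linear_L_algebra_def)
  then show thesis by (rule that)
qed

context descending_enumeration
begin

lemma enum_mem: "i < n \<Longrightarrow> s i \<in> X"
  using bij_betwE[OF bij] by simp

lemma enum_eq_iff: "i < n \<Longrightarrow> k < n \<Longrightarrow> s i = s k \<longleftrightarrow> i = k"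
  using inj_on_eq_iff[OF bij_betw_imp_inj_on[OF bij]] by simp

lemma enum_mult_below:
  assumes "i \<le> j" "j < n" "k < n"
  shows "f (f (s i) (s j)) (f (s i) (s k)) = f (s j) (s k)"
  using assms by (intro L_algebra_mult_below[OF algebra]) (simp_all add: enum_mem le_iff)

lemma enum_0:
  assumes "0 < n"
  shows "s 0 = L_unit X f"
proof -
  obtain u where u: "u < n" "s u = L_unit X f"
    using L_unit_mem[OF algebra] bij_betw_imp_surj_on[OF bij] by (metis imageE lessThan_iff)
  then have "L_le X f (s 0) (s u)"
    using L_unit_right[OF algebra enum_mem[OF assms]] by (simp add: L_le_def)
  then show ?thesis using u assms le_iff[of 0 u] by simp
qed

definition pullback :: "nat \<Rightarrow> nat \<Rightarrow> nat" where
  "pullback i k = (if i < n \<and> k < n then inv_into {..<n} s (f (s i) (s k)) else 0)"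

lemma enum_pullback: "i < n \<Longrightarrow> k < n \<Longrightarrow> s (pullback i k) = f (s i) (s k)"
  using bij_betw_inv_into_right[OF bij] L_algebra_closed[OF algebra] enum_mem
  by (simp add: pullback_def)

lemma pullback_less: "k < n \<Longrightarrow> pullback i k < n"
  using bij_betwE[OF bij_betw_inv_into[OF bij]] L_algebra_closed[OF algebra] enum_mem
  by (simp add: pullback_def)

lemma pullback_eqI:
  assumes "i < n" "k < n" "l < n" "f (s i) (s k) = s l"
  shows "pullback i k = l"
  using assms enum_eq_iff[of "pullback i k" l] by (simp add: enum_pullback pullback_less)

lemma pullback_strict_mono:
  assumes "i \<le> k" "k < l" "l < n"
  shows "pullback i k < pullback i l"
proof -
  have "\<not> L_le X f (s k) (s l)" using assms le_iff[of k l] by simp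
  then have "\<not> L_le X f (s (pullback i k)) (s (pullback i l))"
    using assms by (simp add: L_le_def enum_pullback enum_mult_below)
  then show ?thesis
    using assms le_iff[of "pullback i k" "pullback i l"] by (simp add: pullback_less)
qed

lemma L_chain_pullback: "L_chain n pullback"
proof
  show "pullback 0 k = k" if "k < n" for k
    using that L_unit_left[OF algebra] by (intro pullback_eqI) (simp_all add: enum_0 enum_mem)
  show "pullback i k = 0" if "k \<le> i \<or> n \<le> k" for i k
  proof (cases "i < n \<and> k < n")
    case True
    then show ?thesis
      using that le_iff[of i k] by (intro pullback_eqI) (simp_all add: L_le_def enum_0)
  qed (simp only: pullback_def if_False)
  show "pullback i k < n" if "k < n" for i k
    using that by (rule pullback_less)
  show "strict_mono_on {i..<n} (pullback i)" for i
    by (rule strict_mono_onI) (auto intro: pullback_strict_mono)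
  show "pullback (pullback i j) (pullback i k) = pullback j k"
    if "i \<le> j" "j \<le> k" "k < n" for i j k
    using that by (intro pullback_eqI) (simp_all add: pullback_less enum_pullback enum_mult_below)
qed

lemma L_isomorphic_pullback: "L_isomorphic ({..<n}, pullback) (X, f)"
  unfolding L_isomorphic_def using bij enum_pullback by auto

end

section \<open>Isomorphism classes\<close>

context L_chain
begin

lemma cycloid_unordered:
  assumes "i < n" "j < n" "k < n"
  shows "f (f i j) (f i k) = f (f j i) (f j k)"
proof -
  have "f (f i j) (f i k) = f (f j i) (f j k)" if "i \<le> j" "j < n" "k < n" for i j k
  proof -
    have "f (f i j) (f i k) = f j k"
    proof (cases "j \<le> k")
      case True
      then show ?thesis using that by (simp add: cycloid)
    next
      case False
      then show ?thesis using that row_mono[of k j i] by (simp add: eq_0)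
    qed
    moreover have "f (f j i) (f j k) = f j k"
      using that by (simp add: eq_0 unit_left closed)
    ultimately show ?thesis by simp
  qed
  with assms show ?thesis using linear[of i j] by metis
qed

lemma logical_unit_0: "0 < n \<Longrightarrow> logical_unit {..<n} f 0"
  by (simp add: logical_unit_def unit_left eq_0)

lemma linear_L_algebra_L_chain:
  assumes "0 < n"
  shows "linear_L_algebra {..<n} f"
proof -
  have "L_algebra {..<n} f"
    unfolding L_algebra_def
  proof (intro conjI exI[of _ 0])
    show "logical_unit {..<n} f 0" using assms by (rule logical_unit_0)
  qed (auto simp: closed cycloid_unordered eq_0_iff)
  moreover have "L_le {..<n} f i k \<longleftrightarrow> k \<le> i" if "k < n" for i k
    using that L_unit_eq[OF logical_unit_0[OF assms]] by (simp add: L_le_def eq_0_iff)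
  ultimately show ?thesis by (auto simp: linear_L_algebra_def)
qed

lemma isomorphism_strict_mono:
  assumes h: "bij_betw h {..<n} {..<n}" and "L_chain n f'"
    and hom: "\<And>i k. i < n \<Longrightarrow> k < n \<Longrightarrow> h (f i k) = f' (h i) (h k)"
  shows "strict_mono_on {..<n} h"
proof (rule strict_mono_onI)
  interpret f': L_chain n f' by fact
  fix i k assume ik: "i \<in> {..<n}" "k \<in> {..<n}" "i < k"
  have "h 0 = 0" using hom[of i i] ik by (simp add: eq_0 f'.eq_0)
  then have "f' (h k) (h i) = 0" using hom[of k i] ik by (simp add: eq_0)
  then have "h i \<le> h k"
    using ik bij_betwE[OF h] f'.eq_0_iff[of "h i" "h k"] by simp
  moreover have "h i \<noteq> h k"
    using ik inj_on_eq_iff[OF bij_betw_imp_inj_on[OF h]] by simp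
  ultimately show "h i < h k" by simp
qed

lemma L_isomorphic_imp_eq:
  assumes "L_chain n f'" and "L_isomorphic ({..<n}, f) ({..<n}, f')"
  shows "f = f'"
proof (intro ext)
  interpret f': L_chain n f' by fact
  obtain h where h: "bij_betw h {..<n} {..<n}"
    and hom: "\<And>i k. i < n \<Longrightarrow> k < n \<Longrightarrow> h (f i k) = f' (h i) (h k)"
    using assms(2) by (auto simp: L_isomorphic_def)
  have h_id: "h i = i" if "i < n" for i
    using isomorphism_strict_mono[OF h assms(1) hom] bij_betw_imp_surj_on[OF h] that
    by (intro strict_mono_on_eqI[of "{..<n}" h "\<lambda>i. i"]) (auto simp: strict_mono_on_def)
  fix i k
  show "f i k = f' i k"
  proof (cases "i < k \<and> k < n")
    case True
    then show ?thesis using hom[of i k] h_id by (simp add: closed)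
  next
    case False
    then have "k \<le> i \<or> n \<le> k" by linarith
    then show ?thesis by (simp only: eq_0 f'.eq_0)
  qed
qed

end

lemma num_linear_L_algebras_eq_card_L_chains:
  assumes "0 < n"
  shows "num_linear_L_algebras n = card {f. L_chain n f}"
proof -
  let ?chains = "Pair {..<n} ` {f. L_chain n f}"
  have "card (linear_L_algebras n // L_iso_rel n) = card ?chains"
  proof (rule card_quotient_eq_card_representatives[OF equiv_L_iso_rel])
    show chains: "?chains \<subseteq> linear_L_algebras n"
      using assms by (auto simp: linear_L_algebras_def L_chain.linear_L_algebra_L_chain)
    show "A = B" if "A \<in> ?chains" "B \<in> ?chains" "(A, B) \<in> L_iso_rel n" for A B
      using that L_chain.L_isomorphic_imp_eq by (auto simp: L_iso_rel_def)
    fix A assume A: "A \<in> linear_L_algebras n"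
    then obtain X f where X: "A = (X, f)" "finite X" "linear_L_algebra X f" "card X = n"
      by (auto simp: linear_L_algebras_def)
    obtain s where "descending_enumeration X f n s"
      using linear_L_algebra_descending_enumeration[OF X(2,3)] X(4) by blast
    then interpret descending_enumeration X f n s .
    have "({..<n}, pullback) \<in> ?chains" using L_chain_pullback by simp
    then show "\<exists>B\<in>?chains. (B, A) \<in> L_iso_rel n"
      using A chains L_isomorphic_pullback X(1) unfolding L_iso_rel_def by blast
  qed
  then show ?thesis
    by (simp add: num_linear_L_algebras_def card_image inj_on_def)
qed

theorem theorem4p5:
  fixes n :: nat
  assumes "n \<ge> 1"
  shows "num_linear_L_algebras n = Bell (n - 1)"
proof -
  have "num_linear_L_algebras n = card {f. L_chain (Suc (n - 1)) f}"
    using assms num_linear_L_algebras_eq_card_L_chains[of n] by simp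
  also have "\<dots> = Bell (n - 1)" by (rule card_L_chains)
  finally show ?thesis .
qed

end
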